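(* Let $F^{n}=(M^{n},L)$ be a Finsler space, let $b_i(x,y)$ be an $h$-vector in $F^n$, and let ${}^{*}F^{n}=(M^{n},{}^{*}L)$ be the Finsler space obtained from $F^n$ by the Kropina change with $h$-vector $${}^{*}L(x,y)=\frac{L^2(x,y)}{b_i(x,y)\,y^i}.$$ Let $M^{n-1}$ be a hypersurface of $M^n$, and let $F^{n-1}$ and ${}^{*}F^{n-1}$ be the Finslerian hypersurfaces of $F^n$ and ${}^{*}F^n$, respectively, with this underlying manifold $M^{n-1}$. Then the vector $b_i$ is tangential to the hypersurface $F^{n-1}$ if and only if every vector normal to $F^{n-1}$ is also normal to ${}^{*}F^{n-1}$.
   Context: Notation: $\partial_i=\partial/\partial x^i$, $\dot\partial_i=\partial/\partial y^i$; the summation convention is used. Latin indices run over $1,\dots,n$, Greek indices over $1,\dots,n-1$. Finsler space: $F^n=(M^n,L)$ is an $n$-dimensional smooth manifold with Finsler metric function $L(x,y)$. Set $l_i=\dot\partial_iL$, $g_{ij}=\tfrac12\dot\partial_i\dot\partial_jL^2$, $h_{ij}=L\,\dot\partial_i\dot\partial_jL$, $C_{ijk}=\tfrac12\dot\partial_kg_{ij}$, $C^{h}_{ij}=g^{hk}C_{ijk}$. $h$-vector: a covariant vector field $b_i(x,y)$ is an $h$-vector in $F^n$ if (i) $b_i|_k:=\dot\partial_kb_i-C^r_{ik}b_r=0$ and (ii) $L\,C^h_{ij}b_h=\rho\,h_{ij}$ for a scalar function $\rho\neq0$. (By a known result of Izumi, $\rho$ is independent of $y$.) Kropina change: put $\beta=b_iy^i$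 (nonzero where ${}^{*}L$ is considered). ${}^{*}F^n=(M^n,{}^{*}L)$ is assumed to be a Finsler space; its metric tensor is ${}^{*}g_{ij}=\tfrac12\dot\partial_i\dot\partial_j({}^{*}L)^2$. Hypersurface: $M^{n-1}$ is given parametrically by $x^i=x^i(u^\alpha)$, with $B^i_\alpha=\partial x^i/\partial u^\alpha$ of rank $n-1$. The supporting element is taken tangent to $M^{n-1}$: $y^i=B^i_\alpha(u)v^\alpha$. The Finslerian hypersurfaces are $F^{n-1}=(M^{n-1},\underline L(u,v))$ with $\underline L(u,v)=L(x(u),y(u,v))$, and ${}^{*}F^{n-1}=(M^{n-1},{}^{*}\underline L(u,v))$ with ${}^{*}\underline L(u,v)={}^{*}L(x(u),y(u,v))$. All ambient quantities are evaluated at $(x(u),y(u,v))$. Normality and tangency: a vector $X^j$ at $(u,v)$ is normal to $F^{n-1}$ if $g_{ij}B^i_\alpha X^j=0$ for all $\alpha$, and normal to ${}^{*}F^{n-1}$ if ${}^{*}g_{ij}B^i_\alpha X^j=0$ for all $\alpha$. The unit normal $N^i(u,v)$ of $F^{n-1}$ is defined by $g_{ij}B^i_\alpha N^j=0$, $g_{ij}N^iN^j=1$. The vector $b_i$ is tangential to $F^{n-1}$ if $b_iN^i=0$ along $F^{n-1}$. *)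

theory Defs
  imports "HOL-Analysis.Analysis"
begin

section \<open>Smooth manifolds\<close>

text \<open>Only meant for open \<open>S\<close>: \<open>Ck_on k S f\<close> says that \<open>f\<close> is of class \<open>C^k\<close> on \<open>S\<close>.\<close>

primrec Ck_on ::
  "nat \<Rightarrow> 'a::real_normed_vector set \<Rightarrow> ('a \<Rightarrow> 'b::real_normed_vector) \<Rightarrow> bool" where
  "Ck_on 0 S f \<longleftrightarrow> continuous_on S f"
| "Ck_on (Suc k) S f \<longleftrightarrow>
     (\<forall>x\<in>S. f differentiable (at x)) \<and>
     (\<forall>v. Ck_on k S (\<lambda>x. frechet_derivative f (at x) v))"

definition smooth_on ::
  "'a::real_normed_vector set \<Rightarrow> ('a \<Rightarrow> 'b::real_normed_vector) \<Rightarrow> bool" where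
  "smooth_on S f \<longleftrightarrow> (\<forall>k. Ck_on k S f)"

text \<open>The points of a manifold are all elements of a (Hausdorff, second countable) type; a chart
  is a pair of its domain and its coordinate map.\<close>

type_synonym ('m, 'n) chart = "'m set \<times> ('m \<Rightarrow> real ^ 'n)"

definition is_chart :: "('m::topological_space, 'n::finite) chart \<Rightarrow> bool" where
  "is_chart c \<longleftrightarrow> open (fst c) \<and> open (snd c ` fst c) \<and>
     (\<exists>\<psi>. homeomorphism (fst c) (snd c ` fst c) (snd c) \<psi>)"

definition chart_inv :: "('m, 'n) chart \<Rightarrow> real ^ 'n \<Rightarrow> 'm" where
  "chart_inv c = inv_into (fst c) (snd c)"

definition overlap :: "('m, 'n) chart \<Rightarrow> ('m, 'n) chart \<Rightarrow> (real ^ 'n) set" where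
  "overlap c d = snd c ` (fst c \<inter> fst d)"

definition transition :: "('m, 'n) chart \<Rightarrow> ('m, 'n) chart \<Rightarrow> real ^ 'n \<Rightarrow> real ^ 'n" where
  "transition c d = snd d \<circ> chart_inv c"

definition smooth_atlas :: "('m::topological_space, 'n::finite) chart set \<Rightarrow> bool" where
  "smooth_atlas A \<longleftrightarrow> (\<forall>c\<in>A. is_chart c) \<and> (\<Union>c\<in>A. fst c) = UNIV \<and>
     (\<forall>c\<in>A. \<forall>d\<in>A. smooth_on (overlap c d) (transition c d))"

section \<open>Geometric objects on the tangent bundle\<close>

text \<open>A line element \<open>(x, y)\<close> is given by its coordinates in a chart. Objects on the tangent bundle
  are given, as in classical tensor calculus, by their components in each chart of the atlas,
  subject to the transformation law on overlaps.\<close>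

type_synonym 'n line_elem = "(real ^ 'n) \<times> (real ^ 'n)"

definition transition_TM ::
  "('m, 'n::finite) chart \<Rightarrow> ('m, 'n) chart \<Rightarrow> 'n line_elem \<Rightarrow> 'n line_elem" where
  "transition_TM c d p =
     (transition c d (fst p), frechet_derivative (transition c d) (at (fst p)) (snd p))"

text \<open>The domain \<open>D\<close> of a Finsler metric: an open subset of the slit tangent bundle, stable under
  positive dilatations of \<open>y\<close>. It cannot be required to be the whole slit tangent bundle, because
  the Kropina metric \<open>L^2/\<beta>\<close> is undefined where \<open>\<beta> = 0\<close>. Moreover no \<open>h\<close>-vector exists for a metric
  that is regular in all directions \<open>y \<noteq> 0\<close>: contracting \<open>L C^h_ij b_h = \<rho> h_ij\<close> gives
  \<open>b^h \<partial>/\<partial>y^h (log det g) = 2 (n - 1) \<rho> / L\<close>, but \<open>log det g\<close> is homogeneous of degree 0 in \<open>y\<close>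
  and would attain a maximum, so \<open>\<rho>\<close> would vanish there.\<close>

definition conic_domain ::
  "('m, 'n::finite) chart set \<Rightarrow> (('m, 'n) chart \<Rightarrow> ('n line_elem) set) \<Rightarrow> bool" where
  "conic_domain A D \<longleftrightarrow>
     (\<forall>c\<in>A. open (D c) \<and> D c \<subseteq> (snd c ` fst c) \<times> (- {0}) \<and>
        (\<forall>x \<in> snd c ` fst c. \<exists>y. (x, y) \<in> D c) \<and>
        (\<forall>x y t. (x, y) \<in> D c \<and> t > 0 \<longrightarrow> (x, t *\<^sub>R y) \<in> D c)) \<and>
     (\<forall>c\<in>A. \<forall>d\<in>A. \<forall>x \<in> overlap c d. \<forall>y. (x, y) \<in> D c \<longleftrightarrow> transition_TM c d (x, y) \<in> D d)"

definition scalar_field ::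
  "('m, 'n::finite) chart set \<Rightarrow> (('m, 'n) chart \<Rightarrow> ('n line_elem) set) \<Rightarrow>
   (('m, 'n) chart \<Rightarrow> 'n line_elem \<Rightarrow> real) \<Rightarrow> bool" where
  "scalar_field A D f \<longleftrightarrow>
     (\<forall>c\<in>A. \<forall>d\<in>A. \<forall>p \<in> D c. fst p \<in> overlap c d \<longrightarrow> f c p = f d (transition_TM c d p))"

text \<open>The value of a covector field is the tuple of its components, so that \<open>b \<bullet> w\<close> is the
  contraction \<open>b_i w^i\<close>; the Euclidean inner product has no metric meaning here.\<close>

definition covector_field ::
  "('m, 'n::finite) chart set \<Rightarrow> (('m, 'n) chart \<Rightarrow> ('n line_elem) set) \<Rightarrow>
   (('m, 'n) chart \<Rightarrow> 'n line_elem \<Rightarrow> real ^ 'n) \<Rightarrow> bool" where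
  "covector_field A D b \<longleftrightarrow>
     (\<forall>c\<in>A. smooth_on (D c) (b c)) \<and>
     (\<forall>c\<in>A. \<forall>d\<in>A. \<forall>p \<in> D c. fst p \<in> overlap c d \<longrightarrow>
        (\<forall>w. b c p \<bullet> w
           = b d (transition_TM c d p) \<bullet> frechet_derivative (transition c d) (at (fst p)) w))"

section \<open>Finsler spaces\<close>

text \<open>\<open>vdiff i\<close> is the partial derivative with respect to \<open>y^i\<close>.\<close>

definition vdiff ::
  "'n::finite \<Rightarrow> ('n line_elem \<Rightarrow> real) \<Rightarrow> 'n line_elem \<Rightarrow> real" where
  "vdiff i f p = frechet_derivative (\<lambda>y. f (fst p, y)) (at (snd p)) (axis i 1)"

context
  fixes L :: "'n::finite line_elem \<Rightarrow> real"
begin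

definition metric :: "'n line_elem \<Rightarrow> real ^ 'n ^ 'n" where
  "metric p = (\<chi> i j. (1/2) * vdiff i (vdiff j (\<lambda>q. (L q)\<^sup>2)) p)"

definition angular_metric :: "'n line_elem \<Rightarrow> real ^ 'n ^ 'n" where
  "angular_metric p = (\<chi> i j. L p * vdiff i (vdiff j L) p)"

definition cartan :: "'n \<Rightarrow> 'n \<Rightarrow> 'n \<Rightarrow> 'n line_elem \<Rightarrow> real" where
  "cartan i j k p = (1/2) * vdiff k (\<lambda>q. metric q $ i $ j) p"

text \<open>\<open>cartan_up h i j\<close> is \<open>C^h_ij\<close>.\<close>

definition cartan_up :: "'n \<Rightarrow> 'n \<Rightarrow> 'n \<Rightarrow> 'n line_elem \<Rightarrow> real" where
  "cartan_up h i j p = (\<Sum>k\<in>UNIV. matrix_inv (metric p) $ h $ k * cartan i j k p)"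

end

text \<open>No sign is imposed on \<open>L\<close>. Homogeneity and positive definiteness give
  \<open>L^2 = g_ij y^i y^j > 0\<close>, hence \<open>L \<noteq> 0\<close>; demanding \<open>L > 0\<close> would exclude Kropina metrics with
  \<open>\<beta> < 0\<close>.\<close>

definition finsler_space ::
  "('m, 'n::finite) chart set \<Rightarrow> (('m, 'n) chart \<Rightarrow> ('n line_elem) set) \<Rightarrow>
   (('m, 'n) chart \<Rightarrow> 'n line_elem \<Rightarrow> real) \<Rightarrow> bool" where
  "finsler_space A D L \<longleftrightarrow> conic_domain A D \<and> scalar_field A D L \<and>
     (\<forall>c\<in>A. smooth_on (D c) (L c) \<and>
        (\<forall>x y t. (x, y) \<in> D c \<and> t > 0 \<longrightarrow> L c (x, t *\<^sub>R y) = t * L c (x, y)) \<and>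
        (\<forall>p \<in> D c. \<forall>w. w \<noteq> 0 \<longrightarrow>
           (\<Sum>i\<in>UNIV. \<Sum>j\<in>UNIV. metric (L c) p $ i $ j * w $ i * w $ j) > 0))"

text \<open>The first condition below is \<open>b_i|_k = 0\<close>. The function \<open>\<rho>\<close> may depend on \<open>(x, y)\<close>.\<close>

definition h_vector ::
  "('m, 'n::finite) chart set \<Rightarrow> (('m, 'n) chart \<Rightarrow> ('n line_elem) set) \<Rightarrow>
   (('m, 'n) chart \<Rightarrow> 'n line_elem \<Rightarrow> real) \<Rightarrow>
   (('m, 'n) chart \<Rightarrow> 'n line_elem \<Rightarrow> real ^ 'n) \<Rightarrow> bool" where
  "h_vector A D L b \<longleftrightarrow> covector_field A D b \<and>
     (\<forall>c\<in>A. \<forall>p \<in> D c. \<forall>i k.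
        vdiff k (\<lambda>q. b c q $ i) p - (\<Sum>r\<in>UNIV. cartan_up (L c) r i k p * b c p $ r) = 0) \<and>
     (\<exists>\<rho>. scalar_field A D \<rho> \<and>
        (\<forall>c\<in>A. \<forall>p \<in> D c. \<rho> c p \<noteq> 0 \<and>
           (\<forall>i j. L c p * (\<Sum>h\<in>UNIV. cartan_up (L c) h i j p * b c p $ h)
                  = \<rho> c p * angular_metric (L c) p $ i $ j)))"

definition kropina ::
  "(('m, 'n::finite) chart \<Rightarrow> 'n line_elem \<Rightarrow> real) \<Rightarrow>
   (('m, 'n) chart \<Rightarrow> 'n line_elem \<Rightarrow> real ^ 'n) \<Rightarrow>
   ('m, 'n) chart \<Rightarrow> 'n line_elem \<Rightarrow> real" where
  "kropina L b c p = (L c p)\<^sup>2 / (b c p \<bullet> snd p)"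

section \<open>Hypersurfaces\<close>

text \<open>For a map \<open>\<iota>\<close> between manifolds and charts \<open>e\<close> of the source and \<open>c\<close> of the target,
  \<open>param \<iota> e c\<close> is the coordinate representation \<open>x^i = x^i(u)\<close>, with natural domain
  \<open>param_dom \<iota> e c\<close>; \<open>proj_factor\<close> is the matrix \<open>B^i_\<alpha>\<close>, with row index \<open>i\<close> and column index \<open>\<alpha>\<close>.\<close>

definition param_dom ::
  "('s \<Rightarrow> 'm) \<Rightarrow> ('s, 'k) chart \<Rightarrow> ('m, 'n) chart \<Rightarrow> (real ^ 'k) set" where
  "param_dom \<iota> e c = snd e ` (fst e \<inter> \<iota> -` fst c)"

definition param ::
  "('s \<Rightarrow> 'm) \<Rightarrow> ('s, 'k) chart \<Rightarrow> ('m, 'n) chart \<Rightarrow> real ^ 'k \<Rightarrow> real ^ 'n" where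
  "param \<iota> e c = snd c \<circ> \<iota> \<circ> chart_inv e"

definition proj_factor ::
  "('s \<Rightarrow> 'm) \<Rightarrow> ('s, 'k::finite) chart \<Rightarrow> ('m, 'n::finite) chart \<Rightarrow> real ^ 'k \<Rightarrow> real ^ 'k ^ 'n" where
  "proj_factor \<iota> e c u = matrix (frechet_derivative (param \<iota> e c) (at u))"

definition hypersurface ::
  "('m::topological_space, 'n::finite) chart set \<Rightarrow> ('s::topological_space, 'k::finite) chart set \<Rightarrow>
   ('s \<Rightarrow> 'm) \<Rightarrow> bool" where
  "hypersurface A S \<iota> \<longleftrightarrow> CARD('n) = CARD('k) + 1 \<and> continuous_on UNIV \<iota> \<and>
     (\<forall>e\<in>S. \<forall>c\<in>A. smooth_on (param_dom \<iota> e c) (param \<iota> e c) \<and>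
        (\<forall>u \<in> param_dom \<iota> e c. rank (proj_factor \<iota> e c u) = CARD('k)))"

text \<open>The line element \<open>(x(u), y(u, v))\<close> of the ambient space, with \<open>y^i = B^i_\<alpha> v^\<alpha>\<close>.\<close>

definition support ::
  "('s \<Rightarrow> 'm) \<Rightarrow> ('s, 'k::finite) chart \<Rightarrow> ('m, 'n::finite) chart \<Rightarrow> real ^ 'k \<Rightarrow> real ^ 'k \<Rightarrow>
   'n line_elem" where
  "support \<iota> e c u v = (param \<iota> e c u, proj_factor \<iota> e c u *v v)"

definition normal_to ::
  "(('m, 'n::finite) chart \<Rightarrow> 'n line_elem \<Rightarrow> real) \<Rightarrow> ('s \<Rightarrow> 'm) \<Rightarrow>
   ('s, 'k::finite) chart \<Rightarrow> ('m, 'n) chart \<Rightarrow> real ^ 'k \<Rightarrow> real ^ 'k \<Rightarrow> real ^ 'n \<Rightarrow> bool" where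
  "normal_to L \<iota> e c u v X \<longleftrightarrow>
     (\<forall>\<alpha>. (\<Sum>i\<in>UNIV. \<Sum>j\<in>UNIV.
        metric (L c) (support \<iota> e c u v) $ i $ j * proj_factor \<iota> e c u $ i $ \<alpha> * X $ j) = 0)"

text \<open>The conditions on the unit normal determine it up to sign.\<close>

definition unit_normal ::
  "(('m, 'n::finite) chart \<Rightarrow> 'n line_elem \<Rightarrow> real) \<Rightarrow> ('s \<Rightarrow> 'm) \<Rightarrow>
   ('s, 'k::finite) chart \<Rightarrow> ('m, 'n) chart \<Rightarrow> real ^ 'k \<Rightarrow> real ^ 'k \<Rightarrow> real ^ 'n \<Rightarrow> bool" where
  "unit_normal L \<iota> e c u v N \<longleftrightarrow> normal_to L \<iota> e c u v N \<and>
     (\<Sum>i\<in>UNIV. \<Sum>j\<in>UNIV. metric (L c) (support \<iota> e c u v) $ i $ j * N $ i * N $ j) = 1"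

definition tangential ::
  "('m, 'n::finite) chart set \<Rightarrow> (('m, 'n) chart \<Rightarrow> ('n line_elem) set) \<Rightarrow>
   (('m, 'n) chart \<Rightarrow> 'n line_elem \<Rightarrow> real) \<Rightarrow>
   ('s, 'k::finite) chart set \<Rightarrow> ('s \<Rightarrow> 'm) \<Rightarrow>
   (('m, 'n) chart \<Rightarrow> 'n line_elem \<Rightarrow> real ^ 'n) \<Rightarrow> bool" where
  "tangential A D L S \<iota> b \<longleftrightarrow>
     (\<forall>e\<in>S. \<forall>c\<in>A. \<forall>u \<in> param_dom \<iota> e c. \<forall>v. support \<iota> e c u v \<in> D c \<longrightarrow>
        (\<forall>N. unit_normal L \<iota> e c u v N \<longrightarrow> b c (support \<iota> e c u v) \<bullet> N = 0))"

end

theory Submission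
  imports Defs
begin

text \<open>Write subscripts for derivatives in \<open>y\<close>. The two conditions on an \<open>h\<close>-vector give
  \<open>\<partial>b_i/\<partial>y^k = \<rho> L_ik\<close>, and \<open>L_ik y^i = 0\<close> then yields \<open>\<beta>_k = b_k\<close>. Differentiating \<open>F \<beta> = L^2\<close>
  twice, where \<open>F\<close> is the Kropina metric, expresses the metric of \<open>F\<close> by that of \<open>L\<close>. Let \<open>X\<close> be
  normal and \<open>a\<close> tangent to the hypersurface. As \<open>y\<close> itself is tangent, \<open>L_j X^j = 0\<close> and
  \<open>L_ij a^i X^j = 0\<close>, so that almost everything cancels:
  \<open>\<beta>^2 *g_ij a^i X^j = (b_j X^j) F (F b_i a^i - 2 \<beta> F_i a^i)\<close>.
  For \<open>a = y\<close> the right-hand side is \<open>- (b_j X^j) \<beta> F^2\<close>, which vanishes only if \<open>b_j X^j = 0\<close>.\<close>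

section \<open>Symmetry of second derivatives\<close>

lemma DERIV_along_line:
  fixes f :: "'a::real_normed_vector \<Rightarrow> real"
  assumes "f differentiable (at (x + s *\<^sub>R u))"
  shows "((\<lambda>s. f (x + s *\<^sub>R u)) has_real_derivative frechet_derivative f (at (x + s *\<^sub>R u)) u) (at s)"
proof -
  have f: "(f has_derivative frechet_derivative f (at (x + s *\<^sub>R u))) (at (x + s *\<^sub>R u))"
    using assms frechet_derivative_works by blast
  have "((\<lambda>s. f (x + s *\<^sub>R u)) has_derivative
      (\<lambda>h. frechet_derivative f (at (x + s *\<^sub>R u)) (h *\<^sub>R u))) (at s)"
    by (rule has_derivative_compose[where g = f and f = "\<lambda>s. x + s *\<^sub>R u", OF _ f])
      (auto intro!: derivative_eq_intros)
  then show ?thesis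
    using linear_scale[OF linear_frechet_derivative[OF assms]]
    by (simp add: has_field_derivative_def mult.commute[of _ "frechet_derivative f (at (x + s *\<^sub>R u)) u"])
qed

text \<open>Two applications of the mean value theorem: in direction \<open>u\<close> to the
  increment of \<open>f\<close> over \<open>h\<close> times \<open>v\<close>, then in direction
  \<open>v\<close> to the derivative along \<open>u\<close>. The second difference on the left is
  symmetric in \<open>u\<close> and \<open>v\<close>, so the same statement covers both orders of
  differentiation.\<close>

lemma second_difference_mvt:
  fixes f :: "'a::real_normed_vector \<Rightarrow> real"
  assumes h: "h > 0"
    and f: "\<And>s t. 0 \<le> s \<Longrightarrow> s \<le> h \<Longrightarrow> 0 \<le> t \<Longrightarrow> t \<le> h \<Longrightarrow> f differentiable (at (x + s *\<^sub>R u + t *\<^sub>R v))"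
    and f': "\<And>s t. 0 \<le> s \<Longrightarrow> s \<le> h \<Longrightarrow> 0 \<le> t \<Longrightarrow> t \<le> h \<Longrightarrow>
      (\<lambda>z. frechet_derivative f (at z) u) differentiable (at (x + s *\<^sub>R u + t *\<^sub>R v))"
  obtains s t where "0 < s" "s < h" "0 < t" "t < h"
    "f (x + h *\<^sub>R u + h *\<^sub>R v) - f (x + h *\<^sub>R u) - f (x + h *\<^sub>R v) + f x
      = h\<^sup>2 * frechet_derivative (\<lambda>z. frechet_derivative f (at z) u) (at (x + s *\<^sub>R u + t *\<^sub>R v)) v"
proof -
  let ?f' = "\<lambda>z. frechet_derivative f (at z) u"
  have swap: "x + s *\<^sub>R u + t *\<^sub>R v = (x + t *\<^sub>R v) + s *\<^sub>R u" for s t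
    by simp
  have D: "((\<lambda>s. f (x + s *\<^sub>R u + h *\<^sub>R v) - f (x + s *\<^sub>R u)) has_real_derivative
      ?f' (x + s *\<^sub>R u + h *\<^sub>R v) - ?f' (x + s *\<^sub>R u)) (at s)" if "0 \<le> s" "s \<le> h" for s
    using f[of s h] f[of s 0] that h
    unfolding swap[of _ h]
    by (intro DERIV_diff DERIV_along_line) auto
  obtain s where s: "0 < s" "s < h"
    and s_eq: "(f (x + h *\<^sub>R u + h *\<^sub>R v) - f (x + h *\<^sub>R u))
      - (f (x + 0 *\<^sub>R u + h *\<^sub>R v) - f (x + 0 *\<^sub>R u))
      = (h - 0) * (?f' (x + s *\<^sub>R u + h *\<^sub>R v) - ?f' (x + s *\<^sub>R u))"
    using MVT2[OF h D] by blast
  have D': "((\<lambda>t. ?f' (x + s *\<^sub>R u + t *\<^sub>R v)) has_real_derivative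
      frechet_derivative ?f' (at (x + s *\<^sub>R u + t *\<^sub>R v)) v) (at t)" if "0 \<le> t" "t \<le> h" for t
    using f'[of s t] that s
    by (intro DERIV_along_line) auto
  obtain t where t: "0 < t" "t < h"
    and t_eq: "?f' (x + s *\<^sub>R u + h *\<^sub>R v) - ?f' (x + s *\<^sub>R u + 0 *\<^sub>R v)
      = (h - 0) * frechet_derivative ?f' (at (x + s *\<^sub>R u + t *\<^sub>R v)) v"
    using MVT2[OF h D'] by blast
  show thesis
    using that[OF s t] s_eq t_eq by (simp add: power2_eq_square algebra_simps)
qed

text \<open>Schwarz's theorem. On ever smaller parallelograms at \<open>x\<close> one and the same
  second difference equals a value of either mixed derivative at some nearby point; by continuity
  these values tend to the mixed derivatives at \<open>x\<close>.\<close>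

lemma Ck_on_2_symmetric:
  fixes f :: "'a::real_normed_vector \<Rightarrow> real"
  assumes S: "open S" "x \<in> S" and f: "Ck_on (Suc (Suc 0)) S f"
  shows "frechet_derivative (\<lambda>z. frechet_derivative f (at z) u) (at x) v
       = frechet_derivative (\<lambda>z. frechet_derivative f (at z) v) (at x) u"
proof -
  define G where "G u v z = frechet_derivative (\<lambda>z. frechet_derivative f (at z) u) (at z) v" for u v z
  have df: "f differentiable (at z)" "(\<lambda>z. frechet_derivative f (at z) w) differentiable (at z)"
    if "z \<in> S" for z w
    using f that by auto
  have contG: "isCont (G u v) x" for u v
  proof -
    have "continuous_on S (G u v)"
      using f by (auto simp: G_def)
    then show ?thesis
      using S by (simp add: continuous_on_eq_continuous_at)
  qed
  obtain e where e: "e > 0" "ball x e \<subseteq> S"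
    using S openE by blast
  \<comment> \<open>The last divisor keeps the parallelogram with sides \<open>h n\<close> times
    \<open>u\<close> and \<open>v\<close> strictly inside the ball of radius \<open>e\<close>; its
    summand 1 also covers \<open>u = v = 0\<close>.\<close>
  define h where "h n = e / (real n + 1) / (norm u + norm v + 1)" for n
  have N: "norm u + norm v + 1 > 0"
    by (simp add: add_nonneg_pos)
  have hpos: "h n > 0" for n
    using e N by (simp add: h_def)
  have hlim: "h \<longlonglongrightarrow> 0"
  proof -
    have "(\<lambda>n. e / (norm u + norm v + 1) * inverse (real (Suc n))) \<longlonglongrightarrow> e / (norm u + norm v + 1) * 0"
      by (intro tendsto_mult tendsto_const LIMSEQ_inverse_real_of_nat)
    then show ?thesis
      by (simp add: h_def[abs_def] field_simps)
  qed
  have hle: "h n * (norm u + norm v) < e" for n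
  proof -
    have "h n * (norm u + norm v) < h n * (norm u + norm v + 1)"
      using hpos[of n] by simp
    also have "\<dots> = e / (real n + 1)"
      using N by (simp add: h_def)
    also have "\<dots> \<le> e"
      using e by (simp add: field_simps)
    finally show ?thesis .
  qed
  have bound: "dist (x + s *\<^sub>R u + t *\<^sub>R v) x \<le> k * (norm u + norm v)"
    if "0 \<le> s" "s \<le> k" "0 \<le> t" "t \<le> k" for s t k
  proof -
    have "norm (s *\<^sub>R u + t *\<^sub>R v) \<le> s * norm u + t * norm v"
      using norm_triangle_ineq[of "s *\<^sub>R u" "t *\<^sub>R v"] that by simp
    also have "\<dots> \<le> k * norm u + k * norm v"
      using that by (intro add_mono mult_right_mono) auto
    finally show ?thesis
      by (simp add: dist_norm algebra_simps)
  qed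
  have inS: "x + s *\<^sub>R u + t *\<^sub>R v \<in> S" if "0 \<le> s" "s \<le> h n" "0 \<le> t" "t \<le> h n" for s t n
    using bound[OF that] hle[of n] e by (auto simp: dist_commute subset_iff)
  have "\<exists>p q. dist p x \<le> h n * (norm u + norm v) \<and> dist q x \<le> h n * (norm u + norm v) \<and> G u v p = G v u q" for n
  proof -
    obtain s t where st: "0 < s" "s < h n" "0 < t" "t < h n"
      and 1: "f (x + h n *\<^sub>R u + h n *\<^sub>R v) - f (x + h n *\<^sub>R u) - f (x + h n *\<^sub>R v) + f x
        = (h n)\<^sup>2 * G u v (x + s *\<^sub>R u + t *\<^sub>R v)"
      unfolding G_def
      by (rule second_difference_mvt[OF hpos[of n], of f x u v]) (use df inS in auto)
    have inS': "x + t *\<^sub>R v + s *\<^sub>R u \<in> S" if "0 \<le> s" "s \<le> h n" "0 \<le> t" "t \<le> h n" for s t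
      using inS[OF that] by (simp add: add_ac)
    \<comment> \<open>The same second difference with \<open>u\<close> and \<open>v\<close>
      exchanged. The intermediate point is in general a different one, hence two sequences
      \<open>p\<close> and \<open>q\<close> below.\<close>
    obtain t' s' where st': "0 < t'" "t' < h n" "0 < s'" "s' < h n"
      and 2: "f (x + h n *\<^sub>R v + h n *\<^sub>R u) - f (x + h n *\<^sub>R v) - f (x + h n *\<^sub>R u) + f x
        = (h n)\<^sup>2 * G v u (x + t' *\<^sub>R v + s' *\<^sub>R u)"
      unfolding G_def
      by (rule second_difference_mvt[OF hpos[of n], of f x v u]) (use df inS' in auto)
    have swap: "x + a *\<^sub>R v + b *\<^sub>R u = x + b *\<^sub>R u + a *\<^sub>R v" for a b
      by (simp add: add_ac)
    have "(h n)\<^sup>2 * G u v (x + s *\<^sub>R u + t *\<^sub>R v) = (h n)\<^sup>2 * G v u (x + s' *\<^sub>R u + t' *\<^sub>R v)"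
      using 1 2 unfolding swap by linarith
    then have "G u v (x + s *\<^sub>R u + t *\<^sub>R v) = G v u (x + s' *\<^sub>R u + t' *\<^sub>R v)"
      using hpos[of n] by simp
    then show ?thesis
      using bound st st' by (meson less_imp_le)
  qed
  then obtain p q where
    p: "\<And>n. dist (p n) x \<le> h n * (norm u + norm v)" and
    q: "\<And>n. dist (q n) x \<le> h n * (norm u + norm v)" and
    pq: "\<And>n. G u v (p n) = G v u (q n)"
    by metis
  have lim: "r \<longlonglongrightarrow> x" if "\<And>n. dist (r n) x \<le> h n * (norm u + norm v)" for r
  proof -
    have "(\<lambda>n. h n * (norm u + norm v)) \<longlonglongrightarrow> 0"
      using tendsto_mult_left_zero[OF hlim] .
    then have "(\<lambda>n. dist (r n) x) \<longlonglongrightarrow> 0"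
      by (rule Lim_null_comparison[rotated]) (use that in auto)
    then show ?thesis
      by (rule tendsto_dist_iff[THEN iffD2])
  qed
  have "(\<lambda>n. G u v (p n)) \<longlonglongrightarrow> G u v x" "(\<lambda>n. G v u (q n)) \<longlonglongrightarrow> G v u x"
    by (rule isCont_tendsto_compose[OF contG lim[OF p]], rule isCont_tendsto_compose[OF contG lim[OF q]])
  then show ?thesis
    unfolding pq by (metis (no_types) LIMSEQ_unique G_def)
qed

section \<open>Vertical derivatives\<close>

text \<open>Unlike \<open>vdiff\<close>, this uses the full derivative in \<open>(x, y)\<close>,
  applied to a vertical vector. Thus arbitrary directions are allowed, contractions become linearity
  in \<open>w\<close>, and smoothness in the sense of \<open>smooth_on\<close> passes directly to
  the derivative.\<close>

definition vderiv :: "real ^ 'n \<Rightarrow> ('n::finite line_elem \<Rightarrow> real) \<Rightarrow> 'n line_elem \<Rightarrow> real" where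
  "vderiv w f p = frechet_derivative f (at p) (0, w)"

lemma vdiff_eq_vderiv:
  assumes "f differentiable (at p)"
  shows "vdiff i f p = vderiv (axis i 1) f p"
proof -
  have f: "(f has_derivative frechet_derivative f (at p)) (at (fst p, snd p))"
    using assms unfolding prod.collapse frechet_derivative_works .
  have "((\<lambda>y. f (fst p, y)) has_derivative (\<lambda>h. frechet_derivative f (at p) (0, h))) (at (snd p))"
    by (rule has_derivative_compose[where g = f and f = "\<lambda>y. (fst p, y)", OF _ f])
      (auto intro!: derivative_eq_intros)
  then have "frechet_derivative (\<lambda>y. f (fst p, y)) (at (snd p)) = (\<lambda>h. frechet_derivative f (at p) (0, h))"
    by (rule frechet_derivative_at[symmetric])
  then show ?thesis
    by (simp add: vdiff_def vderiv_def)
qed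

lemma linear_vderiv:
  assumes "f differentiable (at p)"
  shows "linear (\<lambda>w. vderiv w f p)"
proof -
  have "linear (\<lambda>w::real^'n. (0::real^'n, w))"
    by (simp add: linear_iff)
  from linear_compose[OF this linear_frechet_derivative[OF assms]]
  show ?thesis
    by (simp add: vderiv_def o_def)
qed

lemma linear_eq_sum_axis:
  fixes g :: "real ^ 'n \<Rightarrow> real"
  assumes "linear g"
  shows "(\<Sum>i\<in>UNIV. w $ i * g (axis i 1)) = g w"
proof -
  have "g w = g (\<Sum>i\<in>UNIV. w $ i *\<^sub>R axis i 1)"
    using basis_expansion[of w] by (simp add: scalar_mult_eq_scaleR)
  then show ?thesis
    using assms by (simp add: linear_sum linear_scale)
qed

lemma sum_vdiff:
  assumes "f differentiable (at p)"
  shows "(\<Sum>i\<in>UNIV. w $ i * vdiff i f p) = vderiv w f p"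
  using linear_eq_sum_axis[OF linear_vderiv[OF assms]]
  by (simp add: vdiff_eq_vderiv[OF assms])

lemma vderiv_cong:
  assumes "f differentiable (at p)" "open S" "p \<in> S" "\<And>q. q \<in> S \<Longrightarrow> f q = g q"
  shows "vderiv w f p = vderiv w g p"
  using frechet_derivative_transform_within_open[OF assms] by (simp add: vderiv_def)

lemma vderivI: "(f has_derivative f') (at p) \<Longrightarrow> vderiv w f p = f' (0, w)"
  using frechet_derivative_at[of f f' p] by (simp add: vderiv_def)

lemma has_derivative_frechet:
  "f differentiable (at p) \<Longrightarrow> (f has_derivative frechet_derivative f (at p)) (at p)"
  using frechet_derivative_works by blast

lemma vderiv_mult:
  assumes "f differentiable (at p)" "g differentiable (at p)"
  shows "vderiv w (\<lambda>q. f q * g q) p = f p * vderiv w g p + vderiv w f p * g p"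
  using vderivI[OF has_derivative_mult[OF assms[THEN has_derivative_frechet]]]
  by (simp add: vderiv_def)

lemma vderiv_add:
  assumes "f differentiable (at p)" "g differentiable (at p)"
  shows "vderiv w (\<lambda>q. f q + g q) p = vderiv w f p + vderiv w g p"
  using vderivI[OF has_derivative_add[OF assms[THEN has_derivative_frechet]]]
  by (simp add: vderiv_def)

lemma vderiv_cmult:
  assumes "f differentiable (at p)"
  shows "vderiv w (\<lambda>q. c * f q) p = c * vderiv w f p"
  using vderivI[OF has_derivative_mult_right[OF has_derivative_frechet[OF assms]]]
  by (simp add: vderiv_def)

lemma vderiv_power2:
  fixes f :: "'n::finite line_elem \<Rightarrow> real"
  assumes "f differentiable (at p)"
  shows "vderiv w (\<lambda>q. (f q)\<^sup>2) p = 2 * (f p * vderiv w f p)"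
  using vderiv_mult[OF assms assms] by (simp add: power2_eq_square algebra_simps)

lemma vderiv_scale:
  assumes "f differentiable (at (x, t *\<^sub>R y))"
  shows "vderiv w (\<lambda>q. f (fst q, t *\<^sub>R snd q)) (x, y) = t * vderiv w f (x, t *\<^sub>R y)"
proof -
  have f: "(f has_derivative frechet_derivative f (at (x, t *\<^sub>R y))) (at (fst (x, y), t *\<^sub>R snd (x, y)))"
    using assms by (simp add: has_derivative_frechet)
  have "((\<lambda>q. f (fst q, t *\<^sub>R snd q)) has_derivative
      (\<lambda>h. frechet_derivative f (at (x, t *\<^sub>R y)) (fst h, t *\<^sub>R snd h))) (at (x, y))"
    by (rule has_derivative_compose[where g = f and f = "\<lambda>q. (fst q, t *\<^sub>R snd q)", OF _ f])
      (auto intro!: derivative_eq_intros)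
  from vderivI[OF this, of w] linear_scale[OF linear_vderiv[OF assms], of t w]
  show ?thesis
    by (simp add: vderiv_def)
qed

text \<open>Euler's theorem on a single ray: the radial derivative is the slope at
  \<open>t = 1\<close>. Degree 1 homogeneity is the case \<open>a = 0\<close>, degree 0 the case
  \<open>c = 0\<close>.\<close>

lemma vderiv_radial:
  assumes "f differentiable (at (x, y))"
    and "\<And>t. t > 0 \<Longrightarrow> f (x, t *\<^sub>R y) = a + t * c"
  shows "vderiv y f (x, y) = c"
proof -
  have 1: "((\<lambda>s. f ((x, y) + s *\<^sub>R (0, y))) has_real_derivative vderiv y f (x, y)) (at 0)"
    using DERIV_along_line[of f "(x, y)" 0 "(0, y)"] assms(1) by (simp add: vderiv_def)
  have "((\<lambda>s. a + (1 + s) * c) has_real_derivative c) (at 0)"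
    by (auto intro!: derivative_eq_intros)
  then have "((\<lambda>s. f ((x, y) + s *\<^sub>R (0, y))) has_real_derivative c) (at 0)"
  proof (rule DERIV_cong_ev[THEN iffD1, rotated 3])
    \<comment> \<open>The ray parameter is \<open>t = 1 + s\<close>, which must be positive for the
      hypothesis to apply.\<close>
    have "\<forall>\<^sub>F s in nhds 0. s > (-1::real)"
      by (intro order_tendstoD(1)[OF filterlim_ident]) simp
    then show "\<forall>\<^sub>F s in nhds 0. a + (1 + s) * c = f ((x, y) + s *\<^sub>R (0, y))"
    proof eventually_elim
      case (elim s)
      then show ?case
        using assms(2)[of "1 + s"] by (simp add: algebra_simps)
    qed
  qed auto
  then show ?thesis
    using 1 DERIV_unique by blast
qed

section \<open>Smooth functions and their mixed vertical derivatives\<close>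

lemma smooth_on_differentiable:
  assumes "smooth_on S f" "x \<in> S"
  shows "f differentiable (at x)"
proof -
  have "Ck_on (Suc 0) S f"
    using assms(1) by (simp only: smooth_on_def)
  then show ?thesis
    using assms(2) by simp
qed

lemma smooth_on_vderiv:
  assumes "smooth_on S f"
  shows "smooth_on S (vderiv w f)"
  unfolding smooth_on_def vderiv_def[abs_def]
proof
  fix k
  have "Ck_on (Suc k) S f"
    using assms by (simp only: smooth_on_def)
  then show "Ck_on k S (\<lambda>p. frechet_derivative f (at p) (0, w))"
    by simp
qed

lemma vderiv_commute:
  assumes "open S" "p \<in> S" "smooth_on S f"
  shows "vderiv a (vderiv c f) p = vderiv c (vderiv a f) p"
proof -
  have "Ck_on (Suc (Suc 0)) S f"
    using assms(3) by (simp only: smooth_on_def)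
  from Ck_on_2_symmetric[OF assms(1,2) this]
  show ?thesis
    by (simp add: vderiv_def[abs_def])
qed

lemma differentiable_transform_within_open:
  assumes "f differentiable (at p)" "open S" "p \<in> S" "\<And>q. q \<in> S \<Longrightarrow> f q = g q"
  shows "g differentiable (at p)"
  using has_derivative_transform_within_open[OF has_derivative_frechet[OF assms(1)] assms(2-)]
  by (auto simp: differentiable_def)

text \<open>The inner derivative is differentiated again, so \<open>vdiff\<close> and
  \<open>vderiv\<close> have to agree on a whole neighbourhood of \<open>p\<close> before they can
  be exchanged.\<close>

lemma vdiff_vdiff:
  assumes S: "open S" "p \<in> S" and f: "\<And>q. q \<in> S \<Longrightarrow> f differentiable (at q)"
    and f': "vderiv (axis j 1) f differentiable (at p)"
  shows "vdiff i (vdiff j f) p = vderiv (axis i 1) (vderiv (axis j 1) f) p"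
proof -
  have eq: "vderiv (axis j 1) f q = vdiff j f q" if "q \<in> S" for q
    using vdiff_eq_vderiv[OF f[OF that]] by simp
  show ?thesis
    using vdiff_eq_vderiv[OF differentiable_transform_within_open[OF f' S eq]]
      vderiv_cong[OF f' S eq] by simp
qed

text \<open>The summed index sits in the inner derivative, whereas linearity is available for the
  outer one; commuting the two derivatives brings it there.\<close>

lemma sum_vderiv_vderiv:
  assumes S: "open S" "p \<in> S" and f: "smooth_on S f"
  shows "(\<Sum>j\<in>UNIV. c $ j * vderiv a (vderiv (axis j 1) f) p) = vderiv a (vderiv c f) p"
  using linear_eq_sum_axis[OF linear_vderiv, of "vderiv a f" p c]
    smooth_on_differentiable[OF smooth_on_vderiv[OF f] S(2)]
  by (simp add: vderiv_commute[OF S f, of a])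

section \<open>The metric as a bilinear form in vertical derivatives\<close>

lemma inner_matrix_vector_eq_sum:
  fixes G :: "real ^ 'n ^ 'm"
  shows "a \<bullet> (G *v c) = (\<Sum>i\<in>UNIV. \<Sum>j\<in>UNIV. G $ i $ j * a $ i * c $ j)"
  by (simp add: inner_vec_def matrix_vector_mult_def sum_distrib_left mult_ac)

text \<open>The product rule applied twice to half of \<open>L^2\<close> gives
  \<open>g_ij = L_i L_j + L L_ij\<close>; this is then contracted with \<open>a\<close> and
  \<open>c\<close>.\<close>

lemma inner_metric:
  assumes S: "open S" "p \<in> S" and L: "smooth_on S L"
  shows "a \<bullet> (metric L p *v c) = vderiv a L p * vderiv c L p + L p * vderiv a (vderiv c L) p"
proof -
  note dL = smooth_on_differentiable[OF L]
  note dL' = smooth_on_differentiable[OF smooth_on_vderiv[OF L]]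
  have comp: "metric L p $ i $ j = vderiv (axis i 1) L p * vderiv (axis j 1) L p
      + L p * vderiv (axis i 1) (vderiv (axis j 1) L) p" for i j
  proof -
    let ?g = "\<lambda>q. 2 * (L q * vderiv (axis j 1) L q)"
    have eq: "?g q = vderiv (axis j 1) (\<lambda>q. (L q)\<^sup>2) q" if "q \<in> S" for q
      using vderiv_power2[OF dL[OF that]] by simp
    have dm: "(\<lambda>q. L q * vderiv (axis j 1) L q) differentiable (at p)"
      by (rule differentiable_mult[OF dL[OF S(2)] dL'[OF S(2)]])
    have dg: "?g differentiable (at p)"
      by (rule differentiable_mult[OF differentiable_const dm])
    have "vdiff i (vdiff j (\<lambda>q. (L q)\<^sup>2)) p = vderiv (axis i 1) (vderiv (axis j 1) (\<lambda>q. (L q)\<^sup>2)) p"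
      by (intro vdiff_vdiff[OF S] differentiable_transform_within_open[OF dg S eq] differentiable_power dL)
    also have "\<dots> = vderiv (axis i 1) ?g p"
      using vderiv_cong[OF dg S eq] by simp
    also have "\<dots> = 2 * (L p * vderiv (axis i 1) (vderiv (axis j 1) L) p
        + vderiv (axis i 1) L p * vderiv (axis j 1) L p)"
      by (simp add: vderiv_cmult[OF dm] vderiv_mult[OF dL[OF S(2)] dL'[OF S(2)]])
    finally show ?thesis
      by (simp add: metric_def)
  qed
  have "a \<bullet> (metric L p *v c)
      = (\<Sum>i\<in>UNIV. a $ i * vderiv (axis i 1) L p) * (\<Sum>j\<in>UNIV. c $ j * vderiv (axis j 1) L p)
      + L p * (\<Sum>i\<in>UNIV. a $ i * (\<Sum>j\<in>UNIV. c $ j * vderiv (axis i 1) (vderiv (axis j 1) L) p))"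
    unfolding inner_matrix_vector_eq_sum comp sum_product
    unfolding sum_distrib_left sum.distrib[symmetric]
    by (intro sum.cong refl) (simp add: algebra_simps)
  then show ?thesis
    by (simp add: sum_vderiv_vderiv[OF S L] linear_eq_sum_axis[OF linear_vderiv]
        dL[OF S(2)] dL'[OF S(2)])
qed

section \<open>Homogeneous functions\<close>

text \<open>Smoothness and degree 1 homogeneity of a Finsler metric in one fixed chart, to be used
  both for the original metric and for its Kropina change.\<close>

locale homogeneous_fun =
  fixes D :: "('n::finite line_elem) set" and L :: "'n line_elem \<Rightarrow> real"
  assumes open_D: "open D"
    and cone: "(x, y) \<in> D \<Longrightarrow> t > 0 \<Longrightarrow> (x, t *\<^sub>R y) \<in> D"
    and smooth: "smooth_on D L"
    and homogeneous: "(x, y) \<in> D \<Longrightarrow> t > 0 \<Longrightarrow> L (x, t *\<^sub>R y) = t * L (x, y)"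
begin

lemmas differentiable = smooth_on_differentiable[OF smooth]
lemmas differentiable_vderiv = smooth_on_differentiable[OF smooth_on_vderiv[OF smooth]]

lemma euler: "(x, y) \<in> D \<Longrightarrow> vderiv y L (x, y) = L (x, y)"
  by (rule vderiv_radial[where a = 0]) (auto intro: differentiable simp: homogeneous)

text \<open>Differentiating \<open>L (x, t y) = t L (x, y)\<close> in \<open>y\<close> produces a
  factor \<open>t\<close> on both sides, which cancels.\<close>

lemma vderiv_homogeneous:
  assumes xy: "(x, y) \<in> D" and t: "t > 0"
  shows "vderiv w L (x, t *\<^sub>R y) = vderiv w L (x, y)"
proof -
  have "t * vderiv w L (x, y) = vderiv w (\<lambda>q. t * L q) (x, y)"
    using vderiv_cmult[OF differentiable[OF xy]] by simp
  also have "\<dots> = vderiv w (\<lambda>q. L (fst q, t *\<^sub>R snd q)) (x, y)"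
    by (rule vderiv_cong[OF _ open_D xy]) (use differentiable[OF xy] homogeneous t in auto)
  also have "\<dots> = t * vderiv w L (x, t *\<^sub>R y)"
    by (rule vderiv_scale[OF differentiable[OF cone[OF xy t]]])
  finally show ?thesis
    using t by simp
qed

lemma euler_vderiv: "(x, y) \<in> D \<Longrightarrow> vderiv y (vderiv w L) (x, y) = 0"
  by (rule vderiv_radial) (auto intro: differentiable_vderiv simp: vderiv_homogeneous)

text \<open>Both Euler relations enter: \<open>L_i y^i = L\<close> and \<open>L_ij y^i = 0\<close>.
  Hence, where \<open>L\<close> is nonzero, orthogonality to \<open>y\<close> means
  \<open>L_j X^j = 0\<close>.\<close>

lemma inner_metric_radial:
  assumes "(x, y) \<in> D"
  shows "y \<bullet> (metric L (x, y) *v c) = L (x, y) * vderiv c L (x, y)"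
  using inner_metric[OF open_D assms smooth] by (simp add: euler[OF assms] euler_vderiv[OF assms])

lemma nonzero:
  assumes "(x, y) \<in> D" "y \<bullet> (metric L (x, y) *v y) > 0"
  shows "L (x, y) \<noteq> 0"
  using assms(2) by (auto simp: inner_metric_radial[OF assms(1)])

end

section \<open>The Kropina change with an h-vector\<close>

text \<open>In components, \<open>L \<partial>b_i/\<partial>y^k = L C^r_ik b_r = \<rho> h_ik =
  \<rho> L L_ik\<close>. Cancelling \<open>L\<close> and contracting with \<open>w\<close> and
  \<open>a\<close> gives the claim.\<close>

lemma h_vector_vderiv:
  assumes S: "open S" "p \<in> S" and L: "smooth_on S L" and b: "b differentiable (at p)"
    and "L p \<noteq> 0"
    and "\<And>i k. vdiff k (\<lambda>q. b q $ i) p - (\<Sum>r\<in>UNIV. cartan_up L r i k p * b p $ r) = 0"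
    and "\<And>i j. L p * (\<Sum>h\<in>UNIV. cartan_up L h i j p * b p $ h) = \<rho> * angular_metric L p $ i $ j"
  shows "vderiv w (\<lambda>q. b q \<bullet> a) p = \<rho> * vderiv w (vderiv a L) p"
proof -
  note dL = smooth_on_differentiable[OF L]
  note dL' = smooth_on_differentiable[OF smooth_on_vderiv[OF L]]
  have db: "(b has_derivative frechet_derivative b (at p)) (at p)"
    by (rule has_derivative_frechet[OF b])
  have comp: "((\<lambda>q. b q $ i) has_derivative (\<lambda>h. frechet_derivative b (at p) h $ i)) (at p)" for i
    by (rule bounded_linear.has_derivative[OF bounded_linear_vec_nth db])
  have "vdiff k (\<lambda>q. b q $ i) p = \<rho> * vderiv (axis i 1) (vderiv (axis k 1) L) p" for i k
  proof -
    have "L p * vdiff k (\<lambda>q. b q $ i) p = L p * (\<rho> * vderiv (axis i 1) (vderiv (axis k 1) L) p)"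
      using assms(6)[of k i] assms(7)[of i k] vdiff_vdiff[OF S dL dL'[OF S(2)]]
      by (simp add: angular_metric_def)
    then show ?thesis
      using \<open>L p \<noteq> 0\<close> by simp
  qed
  then have vd: "vderiv w (\<lambda>q. b q $ i) p = \<rho> * vderiv w (vderiv (axis i 1) L) p" for i
    using sum_vdiff[of "\<lambda>q. b q $ i" p w] comp[of i]
    by (simp add: differentiableI mult.left_commute[of _ \<rho>] sum_vderiv_vderiv[OF S L]
        vderiv_commute[OF S L, of w] flip: sum_distrib_left)
  have "vderiv w (\<lambda>q. b q \<bullet> a) p = frechet_derivative b (at p) (0, w) \<bullet> a"
    by (rule vderivI[OF has_derivative_inner_left[OF db]])
  also have "\<dots> = (\<Sum>i\<in>UNIV. a $ i * vderiv w (\<lambda>q. b q $ i) p)"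
    by (simp add: inner_vec_def vderivI[OF comp] mult.commute)
  finally show ?thesis
    by (simp add: vd mult.left_commute[of _ \<rho>] sum_vderiv_vderiv[OF S L] flip: sum_distrib_left)
qed

text \<open>The situation in one chart, with \<open>F\<close> the Kropina metric. The h-vector
  conditions enter in the form \<open>vderiv_b\<close>, which \<open>h_vector_vderiv\<close> derives
  from them.\<close>

locale kropina_change =
  L: homogeneous_fun D L + F: homogeneous_fun D F
  for D :: "('n::finite line_elem) set" and L F :: "'n line_elem \<Rightarrow> real" +
  fixes b :: "'n line_elem \<Rightarrow> real ^ 'n" and \<rho> :: "'n line_elem \<Rightarrow> real"
  assumes differentiable_b: "p \<in> D \<Longrightarrow> b differentiable (at p)"
    and vderiv_b: "p \<in> D \<Longrightarrow> vderiv w (\<lambda>q. b q \<bullet> a) p = \<rho> p * vderiv w (vderiv a L) p"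
    and beta_nonzero: "p \<in> D \<Longrightarrow> b p \<bullet> snd p \<noteq> 0"
    and F_eq: "p \<in> D \<Longrightarrow> F p = (L p)\<^sup>2 / (b p \<bullet> snd p)"
begin

definition "\<beta> p = b p \<bullet> snd p"

lemma F_times_\<beta>: "p \<in> D \<Longrightarrow> F p * \<beta> p = (L p)\<^sup>2"
  using beta_nonzero by (simp add: F_eq \<beta>_def)

lemma differentiable_\<beta>: "p \<in> D \<Longrightarrow> \<beta> differentiable (at p)"
  unfolding \<beta>_def[abs_def]
  using differentiable_b bounded_linear_imp_differentiable[OF bounded_linear_snd]
  by (intro differentiable_inner)

lemma differentiable_b_inner: "p \<in> D \<Longrightarrow> (\<lambda>q. b q \<bullet> a) differentiable (at p)"
  using differentiable_b by (intro differentiable_inner) auto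

text \<open>The product rule adds \<open>y^i \<partial>b_i/\<partial>y^k = \<rho> L_ik y^i\<close>
  to \<open>b_k\<close>, and this term vanishes by Euler's relation. To first order,
  \<open>\<beta>\<close> behaves as if \<open>b\<close> were independent of
  \<open>y\<close>.\<close>

lemma vderiv_\<beta>:
  assumes "p \<in> D"
  shows "vderiv w \<beta> p = b p \<bullet> w"
proof -
  have db: "(b has_derivative frechet_derivative b (at p)) (at p)"
    by (rule has_derivative_frechet[OF differentiable_b[OF assms]])
  have "(\<beta> has_derivative (\<lambda>h. b p \<bullet> snd h + frechet_derivative b (at p) h \<bullet> snd p)) (at p)"
    unfolding \<beta>_def[abs_def]
    by (rule has_derivative_inner[OF db has_derivative_snd[OF has_derivative_ident]])
  \<comment> \<open>Here \<open>snd p\<close> is frozen as a constant vector, so that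
    \<open>vderiv_b\<close> applies with \<open>a = snd p\<close>.\<close>
  moreover have "vderiv w (\<lambda>q. b q \<bullet> snd p) p = frechet_derivative b (at p) (0, w) \<bullet> snd p"
    by (rule vderivI[OF has_derivative_inner_left[OF db]])
  moreover have "vderiv w (\<lambda>q. b q \<bullet> snd p) p = 0"
    using vderiv_b[OF assms] vderiv_commute[OF L.open_D assms L.smooth, of w]
      L.euler_vderiv[of "fst p" "snd p"] assms by simp
  ultimately show ?thesis
    using vderivI by fastforce
qed

text \<open>Differentiating \<open>F \<beta> = L^2\<close> instead of the quotient keeps the
  identity polynomial, ready for a second differentiation.\<close>

lemma vderiv_F:
  assumes p: "p \<in> D"
  shows "F p * (b p \<bullet> w) + vderiv w F p * \<beta> p = 2 * (L p * vderiv w L p)"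
proof -
  have "vderiv w (\<lambda>q. F q * \<beta> q) p = vderiv w (\<lambda>q. (L q)\<^sup>2) p"
    using p F.differentiable differentiable_\<beta>
    by (intro vderiv_cong[OF _ L.open_D p] differentiable_mult) (auto simp: F_times_\<beta>)
  then show ?thesis
    using vderiv_mult[OF F.differentiable[OF p] differentiable_\<beta>[OF p]]
      vderiv_power2[OF L.differentiable[OF p]] by (simp add: vderiv_\<beta>[OF p])
qed

text \<open>The dependence of \<open>b\<close> on \<open>y\<close> shows up only now, and only as a
  multiple of \<open>L_ij a^i w^j\<close>, which vanishes when one direction is normal and the other
  tangent.\<close>

lemma vderiv_vderiv_F:
  assumes p: "p \<in> D"
  shows "F p * (\<rho> p * vderiv a (vderiv w L) p) + vderiv a F p * (b p \<bullet> w)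
      + (vderiv w F p * (b p \<bullet> a) + vderiv a (vderiv w F) p * \<beta> p)
    = 2 * (L p * vderiv a (vderiv w L) p + vderiv a L p * vderiv w L p)"
proof -
  note d = F.differentiable[OF p] F.differentiable_vderiv[OF p] differentiable_\<beta>[OF p]
    differentiable_b_inner[OF p] L.differentiable[OF p] L.differentiable_vderiv[OF p]
  have "vderiv a (\<lambda>q. F q * (b q \<bullet> w) + vderiv w F q * \<beta> q) p
      = vderiv a (\<lambda>q. 2 * (L q * vderiv w L q)) p"
    by (rule vderiv_cong[OF _ L.open_D p]) (auto intro!: differentiable_add differentiable_mult d simp: vderiv_F)
  then show ?thesis
    by (simp add: vderiv_add vderiv_mult differentiable_mult d
        vderiv_cmult[OF differentiable_mult[OF d(5,6)]] vderiv_\<beta>[OF p] vderiv_b[OF p])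
qed

text \<open>The assumptions remove every term of \<open>vderiv_F\<close> and
  \<open>vderiv_vderiv_F\<close> that comes from \<open>L\<close>, including the one with
  \<open>\<rho>\<close>. The factor \<open>\<beta>^2\<close> clears the denominators when the rest
  is put into \<open>F_i F_j + F F_ij\<close>.\<close>

lemma inner_metric_F:
  assumes p: "p \<in> D" and "vderiv X L p = 0" "vderiv a (vderiv X L) p = 0"
  shows "(\<beta> p)\<^sup>2 * (a \<bullet> (metric F p *v X))
    = (b p \<bullet> X) * F p * (F p * (b p \<bullet> a) - 2 * \<beta> p * vderiv a F p)"
proof -
  have 1: "vderiv X F p * \<beta> p = - F p * (b p \<bullet> X)"
    using vderiv_F[OF p, of X] assms by simp
  have 2: "vderiv a (vderiv X F) p * \<beta> p = - vderiv a F p * (b p \<bullet> X) - vderiv X F p * (b p \<bullet> a)"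
    using vderiv_vderiv_F[OF p, of a X] assms by simp
  have "(\<beta> p)\<^sup>2 * (a \<bullet> (metric F p *v X))
      = \<beta> p * vderiv a F p * (vderiv X F p * \<beta> p) + F p * \<beta> p * (vderiv a (vderiv X F) p * \<beta> p)"
    by (simp add: inner_metric[OF F.open_D p F.smooth] power2_eq_square algebra_simps)
  also have "\<dots> = \<beta> p * vderiv a F p * (vderiv X F p * \<beta> p)
      - F p * \<beta> p * vderiv a F p * (b p \<bullet> X) - F p * (b p \<bullet> a) * (vderiv X F p * \<beta> p)"
    unfolding 2 by (simp add: algebra_simps)
  also have "\<dots> = (b p \<bullet> X) * F p * (F p * (b p \<bullet> a) - 2 * \<beta> p * vderiv a F p)"
    unfolding 1 by (simp add: algebra_simps)
  finally show ?thesis .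
qed

lemma normal_imp_normal_iff:
  assumes p: "(x, y) \<in> D" and y: "y = B *v v" and nz: "L (x, y) \<noteq> 0"
    and X: "\<And>w. (B *v w) \<bullet> (metric L (x, y) *v X) = 0"
  shows "(\<forall>w. (B *v w) \<bullet> (metric F (x, y) *v X) = 0) \<longleftrightarrow> b (x, y) \<bullet> X = 0"
proof -
  have \<beta>: "\<beta> (x, y) \<noteq> 0"
    using beta_nonzero[OF p] by (simp add: \<beta>_def)
  have F: "F (x, y) \<noteq> 0"
    using F_times_\<beta>[OF p] nz by auto
  \<comment> \<open>The supporting element is itself tangent, so \<open>X\<close> may be tested
    against \<open>y\<close>; testing against the other tangent vectors then isolates the second
    derivatives.\<close>
  have LX: "vderiv X L (x, y) = 0"
    using X[of v] nz by (simp add: L.inner_metric_radial[OF p] flip: y)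
  have LXw: "vderiv (B *v w) (vderiv X L) (x, y) = 0" for w
    using X[of w] nz by (simp add: inner_metric[OF L.open_D p L.smooth] LX)
  note * = inner_metric_F[OF p LX LXw]
  show ?thesis
  proof
    assume "\<forall>w. (B *v w) \<bullet> (metric F (x, y) *v X) = 0"
    then have "y \<bullet> (metric F (x, y) *v X) = 0"
      by (simp add: y)
    \<comment> \<open>For \<open>a = y\<close> both \<open>b_i a^i = \<beta>\<close> and
      \<open>F_i a^i = F\<close> are known, and the last factor is \<open>- \<beta> F\<close>, which
      is nonzero.\<close>
    then have "(b (x, y) \<bullet> X) * F (x, y) * (F (x, y) * \<beta> (x, y) - 2 * \<beta> (x, y) * F (x, y)) = 0"
      using *[of v] F.euler[OF p] by (simp add: \<beta>_def flip: y)
    then show "b (x, y) \<bullet> X = 0"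
      using F \<beta> by simp
  next
    assume "b (x, y) \<bullet> X = 0"
    then show "\<forall>w. (B *v w) \<bullet> (metric F (x, y) *v X) = 0"
      using * \<beta> by simp
  qed
qed

end

section \<open>Normal vectors of the hypersurface\<close>

text \<open>The columns of \<open>proj_factor\<close> span its range, so orthogonality to them is
  orthogonality to every tangent vector, in particular to the supporting element.\<close>

lemma normal_to_iff:
  "normal_to L \<iota> e c u v X \<longleftrightarrow>
    (\<forall>w. (proj_factor \<iota> e c u *v w) \<bullet> (metric (L c) (support \<iota> e c u v) *v X) = 0)"
proof -
  let ?B = "proj_factor \<iota> e c u" and ?z = "metric (L c) (support \<iota> e c u v) *v X"
  have "normal_to L \<iota> e c u v X \<longleftrightarrow> (\<forall>\<alpha>. column \<alpha> ?B \<bullet> ?z = 0)"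
    by (simp add: normal_to_def inner_matrix_vector_eq_sum column_def)
  also have "\<dots> \<longleftrightarrow> transpose ?B *v ?z = 0"
    by (simp add: vec_eq_iff matrix_vector_mult_def column_def inner_vec_def transpose_def)
  also have "\<dots> \<longleftrightarrow> (\<forall>w. w \<bullet> (transpose ?B *v ?z) = 0)"
    by (metis inner_zero_right inner_eq_zero_iff)
  also have "\<dots> \<longleftrightarrow> (\<forall>w. (?B *v w) \<bullet> ?z = 0)"
    by (simp only: dot_lmul_matrix[symmetric, of _ "transpose ?B"] vector_transpose_matrix)
  finally show ?thesis .
qed

lemma unit_normal_iff:
  "unit_normal L \<iota> e c u v N \<longleftrightarrow>
    normal_to L \<iota> e c u v N \<and> N \<bullet> (metric (L c) (support \<iota> e c u v) *v N) = 1"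
  by (simp add: unit_normal_def inner_matrix_vector_eq_sum)

section \<open>From Finsler spaces on the manifold to a single chart\<close>

lemma finsler_space_homogeneous_fun:
  assumes "finsler_space A D L" "c \<in> A"
  shows "homogeneous_fun (D c) (L c)"
proof -
  have "open (D c)"
    and "\<forall>x y t. (x, y) \<in> D c \<and> t > 0 \<longrightarrow> (x, t *\<^sub>R y) \<in> D c"
    and "smooth_on (D c) (L c)"
    and "\<forall>x y t. (x, y) \<in> D c \<and> t > 0 \<longrightarrow> L c (x, t *\<^sub>R y) = t * L c (x, y)"
    using assms by (simp_all add: finsler_space_def conic_domain_def)
  then show ?thesis
    by unfold_locales auto
qed

lemma finsler_space_pos_def:
  assumes "finsler_space A D L" "c \<in> A" "p \<in> D c" "w \<noteq> 0"
  shows "w \<bullet> (metric (L c) p *v w) > 0"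
  using assms by (simp add: finsler_space_def inner_matrix_vector_eq_sum)

text \<open>The domain lies in the slit tangent bundle, so positive definiteness can be applied to
  \<open>y\<close> itself.\<close>

lemma finsler_space_nonzero:
  assumes L: "finsler_space A D L" and c: "c \<in> A" and p: "(x, y) \<in> D c"
  shows "L c (x, y) \<noteq> 0"
proof -
  have "y \<noteq> 0"
    using L c p by (auto simp: finsler_space_def conic_domain_def)
  then show ?thesis
    by (intro homogeneous_fun.nonzero[OF finsler_space_homogeneous_fun[OF L c] p]
        finsler_space_pos_def[OF L c p])
qed

text \<open>Links \<open>tangential\<close>, which speaks of unit normals, with arbitrary normal
  vectors: by positive definiteness every nonzero normal vector can be rescaled to a unit
  normal.\<close>

lemma unit_normal_orthogonal_iff:
  assumes L: "finsler_space A D L" "c \<in> A" "support \<iota> e c u v \<in> D c"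
  shows "(\<forall>N. unit_normal L \<iota> e c u v N \<longrightarrow> z \<bullet> N = 0) \<longleftrightarrow>
    (\<forall>X. normal_to L \<iota> e c u v X \<longrightarrow> z \<bullet> X = 0)"
proof (intro iffI allI impI)
  fix X
  assume unit: "\<forall>N. unit_normal L \<iota> e c u v N \<longrightarrow> z \<bullet> N = 0" and X: "normal_to L \<iota> e c u v X"
  show "z \<bullet> X = 0"
  proof (cases "X = 0")
    case False
    define q where "q = X \<bullet> (metric (L c) (support \<iota> e c u v) *v X)"
    have q: "q > 0"
      unfolding q_def by (rule finsler_space_pos_def[OF L False])
    have "unit_normal L \<iota> e c u v ((1 / sqrt q) *\<^sub>R X)"
      using X q by (simp add: unit_normal_iff normal_to_iff matrix_vector_mult_scaleR flip: q_def)
    then show ?thesis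
      using unit q by fastforce
  qed simp
qed (simp add: unit_normal_def)

lemma kropina_change_h_vector:
  assumes L: "finsler_space A D L" and b: "h_vector A D L b"
    and \<beta>: "\<forall>c\<in>A. \<forall>(x, y) \<in> D c. b c (x, y) \<bullet> y \<noteq> 0"
    and F: "finsler_space A D (kropina L b)" and c: "c \<in> A"
  obtains \<rho> where "kropina_change (D c) (L c) (kropina L b c) (b c) \<rho>"
proof -
  interpret L: homogeneous_fun "D c" "L c"
    by (rule finsler_space_homogeneous_fun[OF L c])
  interpret F: homogeneous_fun "D c" "kropina L b c"
    by (rule finsler_space_homogeneous_fun[OF F c])
  have smooth: "smooth_on (D c) (b c)"
    using b c by (simp add: h_vector_def covector_field_def)
  obtain \<rho> where \<rho>: "\<And>p i j. p \<in> D c \<Longrightarrow> L c p * (\<Sum>h\<in>UNIV. cartan_up (L c) h i j p * b c p $ h)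
      = \<rho> c p * angular_metric (L c) p $ i $ j"
    using b c unfolding h_vector_def by blast
  have "kropina_change (D c) (L c) (kropina L b c) (b c) (\<rho> c)"
  proof
    fix p a w
    assume p: "p \<in> D c"
    show db: "b c differentiable (at p)"
      by (rule smooth_on_differentiable[OF smooth p])
    show "b c p \<bullet> snd p \<noteq> 0"
      using \<beta> c p by (cases p) auto
    have "L c p \<noteq> 0"
      using finsler_space_nonzero[OF L c] p by (cases p) auto
    then show "vderiv w (\<lambda>q. b c q \<bullet> a) p = \<rho> c p * vderiv w (vderiv a (L c)) p"
      using b c p
      by (intro h_vector_vderiv[OF L.open_D p L.smooth db] \<rho>) (auto simp: h_vector_def)
    show "kropina L b c p = (L c p)\<^sup>2 / (b c p \<bullet> snd p)"
      by (simp add: kropina_def)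
  qed
  then show thesis
    by (rule that)
qed

theorem theorem4p1:
  fixes A :: "('m::{t2_space, second_countable_topology}, 'n::finite) chart set"
    and D :: "('m, 'n) chart \<Rightarrow> ('n line_elem) set"
    and L :: "('m, 'n) chart \<Rightarrow> 'n line_elem \<Rightarrow> real"
    and b :: "('m, 'n) chart \<Rightarrow> 'n line_elem \<Rightarrow> real ^ 'n"
    and S :: "('s::{t2_space, second_countable_topology}, 'k::finite) chart set"
    and \<iota> :: "'s \<Rightarrow> 'm"
  assumes "smooth_atlas A"
    and "finsler_space A D L"
    and "h_vector A D L b"
    and "\<forall>c\<in>A. \<forall>(x, y) \<in> D c. b c (x, y) \<bullet> y \<noteq> 0"
    and "finsler_space A D (kropina L b)"
    and "smooth_atlas S"
    and "hypersurface A S \<iota>"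
  shows "tangential A D L S \<iota> b \<longleftrightarrow>
    (\<forall>e\<in>S. \<forall>c\<in>A. \<forall>u \<in> param_dom \<iota> e c. \<forall>v. support \<iota> e c u v \<in> D c \<longrightarrow>
       (\<forall>X. normal_to L \<iota> e c u v X \<longrightarrow> normal_to (kropina L b) \<iota> e c u v X))"
proof -
  \<comment> \<open>The equivalence already holds at each single line element and in each pair of
    charts; the theorem follows by quantifying over them.\<close>
  have "(\<forall>N. unit_normal L \<iota> e c u v N \<longrightarrow> b c (support \<iota> e c u v) \<bullet> N = 0) \<longleftrightarrow>
      (\<forall>X. normal_to L \<iota> e c u v X \<longrightarrow> normal_to (kropina L b) \<iota> e c u v X)"
    if c: "c \<in> A" and p: "support \<iota> e c u v \<in> D c" for e c u v
  proof -
    obtain \<rho> where "kropina_change (D c) (L c) (kropina L b c) (b c) \<rho>"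
      by (rule kropina_change_h_vector[OF assms(2-5) c])
    then interpret kropina_change "D c" "L c" "kropina L b c" "b c" \<rho> .
    have p': "(param \<iota> e c u, proj_factor \<iota> e c u *v v) \<in> D c"
      using p by (simp add: support_def)
    have "normal_to (kropina L b) \<iota> e c u v X \<longleftrightarrow> b c (support \<iota> e c u v) \<bullet> X = 0"
      if "normal_to L \<iota> e c u v X" for X
      using that normal_imp_normal_iff[OF p' refl finsler_space_nonzero[OF assms(2) c p'], of X]
      by (simp add: normal_to_iff support_def)
    then show ?thesis
      by (auto simp: unit_normal_orthogonal_iff[OF assms(2) c p])
  qed
  then show ?thesis
    unfolding tangential_def by blast
qed

end
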